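(* Let $\mathbf{d}=(d_1,\dots,d_n)$ be a multigraphical sequence. Then $\mathbf{d}$ admits a realization which is a $C_4$-pivotable multigraph if and only if $\sum_{i=1}^n d_i=4(n-1)-4$ and $d_n\ge 2$.
   Context: A degree sequence is non-increasing, $d_1\ge\dots\ge d_n\ge 0$; it is multigraphical if some loopless multigraph on $v_1,\dots,v_n$ has $\deg(v_i)=d_i$ (a realization). A spanning tree of a multigraph is a set of edges (specific parallel copies) forming a tree on all vertices. A loopless multigraph $G$ on $n$ vertices with exactly $2n-4$ edges is a $C_4$-pivotable multigraph if $G$ contains an induced cycle $C$ of length 4 (the central cycle; induced meaning no chords, and additionally each edge of $C$ has multiplicity exactly one in $G$) and two spanning trees having exactly two common edges, both of which are edges of $C$. *)

theory Defs imports Main begin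

text \<open>Edges carry their own identity, so parallel edges are different elements of \<open>edges G\<close>
  with the same set of end vertices.\<close>

record ('v, 'e) multigraph =
  verts :: "'v set"
  edges :: "'e set"
  ends  :: "'e \<Rightarrow> 'v set"

definition loopless_multigraph :: "('v, 'e) multigraph \<Rightarrow> bool" where
  "loopless_multigraph G \<longleftrightarrow>
     finite (verts G) \<and> finite (edges G) \<and>
     (\<forall>e\<in>edges G. ends G e \<subseteq> verts G \<and> card (ends G e) = 2)"

text \<open>Counting incident edges is the degree because there are no loops.\<close>

definition deg :: "('v, 'e) multigraph \<Rightarrow> 'v \<Rightarrow> nat" where
  "deg G v = card {e \<in> edges G. v \<in> ends G e}"

definition multiplicity :: "('v, 'e) multigraph \<Rightarrow> 'v set \<Rightarrow> nat" where
  "multiplicity G p = card {e \<in> edges G. ends G e = p}"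

text \<open>The cycle visits \<open>vs ! 0, vs ! 1, \<dots>\<close> in this order and \<open>es ! i\<close> leads from \<open>vs ! i\<close> to its
  cyclic successor. Two parallel edges form a cycle of length 2.\<close>

definition is_cycle :: "('v, 'e) multigraph \<Rightarrow> 'v list \<Rightarrow> 'e list \<Rightarrow> bool" where
  "is_cycle G vs es \<longleftrightarrow>
     vs \<noteq> [] \<and> length es = length vs \<and> distinct vs \<and> distinct es \<and>
     set vs \<subseteq> verts G \<and> set es \<subseteq> edges G \<and>
     (\<forall>i < length vs. ends G (es ! i) = {vs ! i, vs ! (Suc i mod length vs)})"

definition is_connected :: "('v, 'e) multigraph \<Rightarrow> bool" where
  "is_connected G \<longleftrightarrow> verts G \<noteq> {} \<and>
     (\<forall>u\<in>verts G. \<forall>v\<in>verts G. (u, v) \<in> {(x, y). \<exists>e\<in>edges G. ends G e = {x, y}}\<^sup>*)"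

definition is_tree :: "('v, 'e) multigraph \<Rightarrow> bool" where
  "is_tree G \<longleftrightarrow> is_connected G \<and> (\<nexists>vs es. is_cycle G vs es)"

definition spanning_tree :: "('v, 'e) multigraph \<Rightarrow> 'e set \<Rightarrow> bool" where
  "spanning_tree G T \<longleftrightarrow> T \<subseteq> edges G \<and> is_tree (G\<lparr>edges := T\<rparr>)"

text \<open>Chordless, and every edge of the cycle has multiplicity one in the whole multigraph.\<close>

definition induced_cycle :: "('v, 'e) multigraph \<Rightarrow> 'v list \<Rightarrow> 'e list \<Rightarrow> bool" where
  "induced_cycle G vs es \<longleftrightarrow>
     is_cycle G vs es \<and>
     (\<forall>e\<in>edges G. ends G e \<subseteq> set vs \<longrightarrow> (\<exists>f\<in>set es. ends G e = ends G f)) \<and>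
     (\<forall>f\<in>set es. multiplicity G (ends G f) = 1)"

definition C4_pivotable :: "('v, 'e) multigraph \<Rightarrow> bool" where
  "C4_pivotable G \<longleftrightarrow>
     loopless_multigraph G \<and>
     int (card (edges G)) = 2 * int (card (verts G)) - 4 \<and>
     (\<exists>vs es. induced_cycle G vs es \<and> length vs = 4 \<and>
        (\<exists>S T. spanning_tree G S \<and> spanning_tree G T \<and>
           card (S \<inter> T) = 2 \<and> S \<inter> T \<subseteq> set es))"

text \<open>A sequence is given by \<open>n\<close> and \<open>d\<close>; only the values \<open>d 1, \<dots>, d n\<close> matter, and the vertex
  \<open>v\<^sub>i\<close> is the number \<open>i\<close>.\<close>

definition degree_sequence :: "nat \<Rightarrow> (nat \<Rightarrow> nat) \<Rightarrow> bool" where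
  "degree_sequence n d \<longleftrightarrow> (\<forall>i j. 1 \<le> i \<and> i \<le> j \<and> j \<le> n \<longrightarrow> d j \<le> d i)"

definition realization :: "(nat, 'e) multigraph \<Rightarrow> nat \<Rightarrow> (nat \<Rightarrow> nat) \<Rightarrow> bool" where
  "realization G n d \<longleftrightarrow>
     loopless_multigraph G \<and> verts G = {1..n} \<and> (\<forall>i\<in>{1..n}. deg G i = d i)"

text \<open>Edge sets are finite, so taking natural numbers as edge names is no restriction.\<close>

definition multigraphical :: "nat \<Rightarrow> (nat \<Rightarrow> nat) \<Rightarrow> bool" where
  "multigraphical n d \<longleftrightarrow>
     degree_sequence n d \<and> (\<exists>G :: (nat, nat) multigraph. realization G n d)"

end

theory Submission imports Defs begin

text \<open>If some \<open>v\<close> had degree 1, its edge would lie in both spanning trees, hence on the central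
  cycle, which would give \<open>v\<close> degree 2; the sum condition is the handshake lemma. Conversely, induct
  on the number of vertices, keeping \<open>S \<union> T\<close> equal to the whole edge set. For \<open>n > 4\<close> some vertex
  has degree 2 or 3. A new vertex of degree 2 is attached by one edge of \<open>S\<close> and one of \<open>T\<close>. A new
  vertex \<open>v\<close> of degree 3 is first attached in this way, by the edge \<open>{v, x}\<close> of \<open>S\<close> say, and then an
  edge \<open>{x, y}\<close> of \<open>S\<close> off the central cycle is slid along \<open>{v, x}\<close>, that is, replaced by \<open>{v, y}\<close>.
  Neither operation touches the central cycle.\<close>

section \<open>Reachability and connectedness\<close>

definition adj :: "('e \<Rightarrow> 'v set) \<Rightarrow> 'e set \<Rightarrow> ('v \<times> 'v) set" where
  "adj f E = {(x, y). \<exists>e\<in>E. f e = {x, y}}"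

lemma adjI: "e \<in> E \<Longrightarrow> f e = {x, y} \<Longrightarrow> (x, y) \<in> adj f E"
  by (auto simp: adj_def)

lemma adj_mono: "E \<subseteq> E' \<Longrightarrow> adj f E \<subseteq> adj f E'"
  by (auto simp: adj_def)

lemma adj_cong: "(\<And>e. e \<in> E \<Longrightarrow> f e = g e) \<Longrightarrow> adj f E = adj g E"
  by (auto simp: adj_def)

lemma rtrancl_adj_sym: "(x, y) \<in> (adj f E)\<^sup>* \<Longrightarrow> (y, x) \<in> (adj f E)\<^sup>*"
proof -
  have "sym (adj f E)"
    by (auto simp: sym_def adj_def insert_commute)
  then show "(x, y) \<in> (adj f E)\<^sup>* \<Longrightarrow> (y, x) \<in> (adj f E)\<^sup>*"
    by (meson sym_rtrancl symD)
qed

lemma rtrancl_adj_insertD: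
  assumes "(v, w) \<in> (adj f (insert e E))\<^sup>*"
  shows "(v, w) \<in> (adj f E)\<^sup>* \<or>
    (\<exists>x y. f e = {x, y} \<and> (v, x) \<in> (adj f E)\<^sup>* \<and> (y, w) \<in> (adj f E)\<^sup>*)"
  using assms
proof (induction rule: converse_rtrancl_induct)
  case base
  then show ?case by simp
next
  case (step u v)
  from step.hyps(1) consider (old) "(u, v) \<in> adj f E" | (new) "f e = {u, v}"
    by (auto simp: adj_def)
  then show ?case
  proof cases
    case old
    then show ?thesis using step.IH by (meson converse_rtrancl_into_rtrancl)
  next
    case new
    then show ?thesis using step.IH by (auto simp: doubleton_eq_iff)
  qed
qed

lemma card_le_card_edges_plus_targets:
  assumes "finite E" "finite W" and "\<forall>v\<in>V. \<exists>w\<in>W. (v, w) \<in> (adj f E)\<^sup>*"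
  shows "card V \<le> card E + card W"
  using assms
proof (induction E arbitrary: W rule: finite_induct)
  case empty
  have "adj f {} = {}" by (simp add: adj_def)
  with empty have "V \<subseteq> W" by auto
  then show ?case using empty by (simp add: card_mono)
next
  case (insert e E)
  let ?r = "(adj f E)\<^sup>*"
  show ?case
  proof (cases "\<exists>x y. f e = {x, y} \<and> (\<exists>w\<in>W. (y, w) \<in> ?r)")
    case True
    then obtain x y w where xy: "f e = {x, y}" and w: "w \<in> W" "(y, w) \<in> ?r" by blast
    have "\<exists>u\<in>insert x W. (v, u) \<in> ?r" if "v \<in> V" for v
    proof -
      obtain u where u: "u \<in> W" "(v, u) \<in> (adj f (insert e E))\<^sup>*"
        using bspec[OF insert.prems(2) \<open>v \<in> V\<close>] by (elim bexE)
      from rtrancl_adj_insertD[OF u(2)] xy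
      consider "(v, u) \<in> ?r" | "(v, x) \<in> ?r" | "(v, y) \<in> ?r" by (auto simp: doubleton_eq_iff)
      then show ?thesis using u(1) w by cases (auto intro: rtrancl_trans)
    qed
    then have "card V \<le> card E + card (insert x W)"
      using insert.prems(1) by (intro insert.IH) auto
    also have "\<dots> \<le> card E + Suc (card W)"
      using insert.prems(1) by (simp add: card_insert_if)
    finally show ?thesis using insert.hyps by simp
  next
    case False
    then have "\<forall>v\<in>V. \<exists>w\<in>W. (v, w) \<in> ?r"
      using insert.prems(2) by (meson rtrancl_adj_insertD)
    then show ?thesis using insert.IH insert.prems(1) insert.hyps by fastforce
  qed
qed

lemma is_connected_adj:
  "is_connected G \<longleftrightarrow> verts G \<noteq> {} \<and>
    (\<forall>u\<in>verts G. \<forall>v\<in>verts G. (u, v) \<in> (adj (ends G) (edges G))\<^sup>*)"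
  by (simp add: is_connected_def adj_def)

lemma is_connectedI:
  assumes "w \<in> verts G" and "\<And>v. v \<in> verts G \<Longrightarrow> (v, w) \<in> (adj (ends G) (edges G))\<^sup>*"
  shows "is_connected G"
  unfolding is_connected_adj using assms by (blast intro: rtrancl_trans rtrancl_adj_sym)

lemma is_connected_transfer:
  assumes con: "is_connected G" and sub: "verts G \<subseteq> verts H"
    and adj: "adj (ends G) (edges G) \<subseteq> (adj (ends H) (edges H))\<^sup>*"
    and new: "\<And>v. v \<in> verts H - verts G \<Longrightarrow>
      \<exists>u\<in>verts G. (v, u) \<in> (adj (ends H) (edges H))\<^sup>*"
  shows "is_connected H"
proof -
  obtain w where w: "w \<in> verts G" using con by (auto simp: is_connected_def)
  have old: "(u, w) \<in> (adj (ends H) (edges H))\<^sup>*" if "u \<in> verts G" for u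
    using con that w rtrancl_subset_rtrancl[OF adj] by (auto simp: is_connected_adj)
  show ?thesis
  proof (rule is_connectedI)
    show "(v, w) \<in> (adj (ends H) (edges H))\<^sup>*" if "v \<in> verts H" for v
      using that old new by (cases "v \<in> verts G") (blast intro: rtrancl_trans)+
  qed (use w sub in auto)
qed

lemma is_connected_replace_edge:
  assumes con: "is_connected G" and verts: "verts H = verts G"
    and kept: "\<And>g. g \<in> edges G \<Longrightarrow> g \<noteq> e \<Longrightarrow> g \<in> edges H \<and> ends H g = ends G g"
    and detour: "\<And>x y. ends G e = {x, y} \<Longrightarrow> (x, y) \<in> (adj (ends H) (edges H))\<^sup>*"
  shows "is_connected H"
proof (rule is_connected_transfer[OF con])
  show "adj (ends G) (edges G) \<subseteq> (adj (ends H) (edges H))\<^sup>*"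
  proof (rule subrelI)
    fix x y assume "(x, y) \<in> adj (ends G) (edges G)"
    then obtain g where g: "g \<in> edges G" "ends G g = {x, y}" by (auto simp: adj_def)
    show "(x, y) \<in> (adj (ends H) (edges H))\<^sup>*"
    proof (cases "g = e")
      case True
      then show ?thesis using g(2) detour by simp
    next
      case False
      then show ?thesis using g kept[OF g(1)] by (intro r_into_rtrancl adjI[of g]) auto
    qed
  qed
qed (use verts in auto)

lemma is_connected_card_verts_le:
  assumes "is_connected G" and "finite (edges G)"
  shows "card (verts G) \<le> card (edges G) + 1"
proof -
  obtain w where "w \<in> verts G" using assms(1) by (auto simp: is_connected_def)
  then show ?thesis
    using assms card_le_card_edges_plus_targets[of "edges G" "{w}" "verts G" "ends G"]
    by (simp add: is_connected_adj)
qed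

lemma is_connected_has_incident_edge:
  assumes "is_connected G" "u \<in> verts G" "v \<in> verts G" "u \<noteq> v"
  shows "\<exists>e\<in>edges G. v \<in> ends G e"
proof -
  have "(v, u) \<in> (adj (ends G) (edges G))\<^sup>*"
    using assms by (simp add: is_connected_adj)
  then show ?thesis
    by (cases rule: converse_rtranclE) (use assms in \<open>auto simp: adj_def\<close>)
qed

section \<open>Cycles and trees\<close>

lemma is_cycle_ends:
  assumes "is_cycle G vs es" "i < length vs"
  shows "ends G (es ! i) = {vs ! i, vs ! (Suc i mod length vs)}"
  using assms by (simp add: is_cycle_def)

lemma is_cycle_ends_subset:
  assumes cyc: "is_cycle G vs es" and e: "e \<in> set es"
  shows "ends G e \<subseteq> set vs"
proof -
  obtain i where i: "i < length vs" "e = es ! i"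
    using cyc e by (auto simp: in_set_conv_nth is_cycle_def)
  then have "Suc i mod length vs < length vs" by (intro mod_less_divisor) auto
  then show ?thesis using is_cycle_ends[OF cyc] i by simp
qed

lemma rtrancl_adj_walk_around_cycle:
  assumes cyc: "is_cycle G vs es" and i: "i < length vs" and j: "j < length vs"
  shows "(vs ! (Suc i mod length vs), vs ! ((Suc i + j) mod length vs))
    \<in> (adj (ends G) (set es - {es ! i}))\<^sup>*"
  using j
proof (induction j)
  case (Suc j)
  let ?k = "length vs"
  let ?m = "(Suc i + j) mod ?k"
  have es: "length es = ?k" "distinct es" using cyc by (auto simp: is_cycle_def)
  have m: "?m < ?k" using i by (intro mod_less_divisor) auto
  have "?m \<noteq> i"
  proof
    assume "?m = i"
    then have "(i + Suc j) mod ?k = i mod ?k" using i by simp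
    then have "?k dvd Suc j" by (metis add_diff_cancel_left' le_add1 mod_eq_dvd_iff_nat)
    then show False using Suc.prems by (auto dest: dvd_imp_le)
  qed
  then have "es ! ?m \<in> set es - {es ! i}"
    using i m es by (simp add: nth_eq_iff_index_eq)
  moreover have "ends G (es ! ?m) = {vs ! ?m, vs ! ((Suc i + Suc j) mod ?k)}"
    using is_cycle_ends[OF cyc m] by (simp add: mod_Suc_eq)
  ultimately have "(vs ! ?m, vs ! ((Suc i + Suc j) mod ?k)) \<in> adj (ends G) (set es - {es ! i})"
    by (rule adjI)
  then show ?case using Suc by (meson Suc_lessD rtrancl.rtrancl_into_rtrancl)
qed simp

lemma rtrancl_adj_cycle_delete_edge:
  assumes cyc: "is_cycle G vs es" and e: "e \<in> set es" and uw: "u \<in> set vs" "w \<in> set vs"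
  shows "(u, w) \<in> (adj (ends G) (set es - {e}))\<^sup>*"
proof -
  let ?k = "length vs" and ?r = "(adj (ends G) (set es - {e}))\<^sup>*"
  obtain i where i: "i < ?k" "e = es ! i"
    using cyc e by (auto simp: in_set_conv_nth is_cycle_def)
  have reach: "(vs ! (Suc i mod ?k), v) \<in> ?r" if "v \<in> set vs" for v
  proof -
    obtain m where m: "m < ?k" "v = vs ! m" using \<open>v \<in> set vs\<close> by (auto simp: in_set_conv_nth)
    define j where "j = (m + (?k - Suc i)) mod ?k"
    have "(Suc i + j) mod ?k = (Suc i + (m + (?k - Suc i))) mod ?k"
      unfolding j_def by (rule mod_add_right_eq)
    also have "Suc i + (m + (?k - Suc i)) = m + ?k" using i(1) by linarith
    finally have "v = vs ! ((Suc i + j) mod ?k)" using m by simp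
    moreover have "j < ?k" unfolding j_def using i(1) by (intro mod_less_divisor) auto
    ultimately show ?thesis using rtrancl_adj_walk_around_cycle[OF cyc i(1)] i(2) by simp
  qed
  show ?thesis using reach[OF uw(1)] reach[OF uw(2)] by (meson rtrancl_adj_sym rtrancl_trans)
qed

lemma is_connected_delete_cycle_edge:
  assumes con: "is_connected G" and cyc: "is_cycle G vs es" and e: "e \<in> set es"
  shows "is_connected (G\<lparr>edges := edges G - {e}\<rparr>)"
proof (rule is_connected_replace_edge[OF con])
  fix x y assume "ends G e = {x, y}"
  then have "x \<in> set vs" "y \<in> set vs" using is_cycle_ends_subset[OF cyc e] by auto
  then have "(x, y) \<in> (adj (ends G) (set es - {e}))\<^sup>*"
    by (rule rtrancl_adj_cycle_delete_edge[OF cyc e])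
  moreover have "adj (ends G) (set es - {e}) \<subseteq> adj (ends G) (edges G - {e})"
    using cyc by (intro adj_mono) (auto simp: is_cycle_def)
  ultimately show "(x, y) \<in> (adj (ends (G\<lparr>edges := edges G - {e}\<rparr>))
      (edges (G\<lparr>edges := edges G - {e}\<rparr>)))\<^sup>*"
    using rtrancl_mono by auto
qed auto

definition minimally_connected :: "('v, 'e) multigraph \<Rightarrow> bool" where
  "minimally_connected G \<longleftrightarrow> is_connected G \<and> card (edges G) + 1 = card (verts G)"

lemma minimally_connected_cong:
  assumes "verts G = verts H" "edges G = edges H" "\<And>e. e \<in> edges H \<Longrightarrow> ends G e = ends H e"
  shows "minimally_connected G \<longleftrightarrow> minimally_connected H"
  using assms adj_cong[of "edges H" "ends G" "ends H"]
  by (simp add: minimally_connected_def is_connected_adj)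

lemma minimally_connected_imp_is_tree:
  assumes G: "minimally_connected G" and fin: "finite (edges G)"
  shows "is_tree G"
proof -
  have False if cyc: "is_cycle G vs es" for vs es
  proof -
    obtain e where e: "e \<in> set es" "e \<in> edges G"
      using cyc by (cases es) (auto simp: is_cycle_def)
    have "card (verts G) \<le> card (edges G - {e}) + 1"
      using is_connected_card_verts_le[OF is_connected_delete_cycle_edge[OF _ cyc e(1)]] G fin
      by (simp add: minimally_connected_def)
    moreover have "card (edges G - {e}) < card (edges G)"
      using e(2) fin by (intro card_Diff1_less)
    ultimately show False using G by (simp add: minimally_connected_def)
  qed
  then show ?thesis using G by (auto simp: is_tree_def minimally_connected_def)
qed

section \<open>Degrees\<close>

lemma loopless_multigraph_finite:
  assumes "loopless_multigraph G"
  shows "finite (verts G)" "finite (edges G)"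
  using assms by (auto simp: loopless_multigraph_def)

lemma handshake:
  assumes "loopless_multigraph G"
  shows "(\<Sum>v\<in>verts G. deg G v) = 2 * card (edges G)"
proof -
  have "(\<Sum>v\<in>verts G. deg G v) = (\<Sum>v\<in>verts G. \<Sum>e | e \<in> edges G \<and> v \<in> ends G e. 1)"
    by (simp add: deg_def)
  also have "\<dots> = (\<Sum>e\<in>edges G. \<Sum>v | v \<in> verts G \<and> v \<in> ends G e. 1)"
    by (rule sum.swap_restrict[OF loopless_multigraph_finite[OF assms]])
  also have "\<dots> = (\<Sum>e\<in>edges G. 2)"
  proof (rule sum.cong)
    fix e assume "e \<in> edges G"
    then have "{v. v \<in> verts G \<and> v \<in> ends G e} = ends G e" "card (ends G e) = 2"
      using assms by (auto simp: loopless_multigraph_def)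
    then show "(\<Sum>v | v \<in> verts G \<and> v \<in> ends G e. 1) = (2 :: nat)" by simp
  qed simp
  finally show ?thesis by simp
qed

lemma deg_outside:
  assumes "loopless_multigraph G" "v \<notin> verts G"
  shows "deg G v = 0"
  using assms by (auto simp: deg_def loopless_multigraph_def)

lemma deg_ge_2_if_two_edges:
  assumes "finite (edges G)" "e \<noteq> f" "e \<in> edges G" "f \<in> edges G" "v \<in> ends G e" "v \<in> ends G f"
  shows "deg G v \<ge> 2"
proof -
  have "card {e, f} \<le> deg G v"
    unfolding deg_def using assms by (intro card_mono) auto
  then show ?thesis using assms(2) by simp
qed

lemma cycle_vertex_deg_ge_2:
  assumes G: "loopless_multigraph G" and cyc: "is_cycle G vs es" and v: "v \<in> set vs"
  shows "deg G v \<ge> 2"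
proof -
  let ?k = "length vs"
  have es: "length es = ?k" "distinct es" "set es \<subseteq> edges G"
    using cyc by (auto simp: is_cycle_def)
  obtain j where j: "j < ?k" "v = vs ! j" using v by (auto simp: in_set_conv_nth)
  have "es ! j \<in> edges G" using es j(1) by auto
  then have "card (ends G (es ! j)) = 2" using G by (simp add: loopless_multigraph_def)
  then have "?k \<noteq> 1" using is_cycle_ends[OF cyc j(1)] j(1) by auto
  define i where "i = (if j = 0 then ?k - 1 else j - 1)"
  have i: "i < ?k" "i \<noteq> j" "Suc i mod ?k = j"
    using j(1) \<open>?k \<noteq> 1\<close> by (auto simp: i_def)
  show ?thesis
  proof (rule deg_ge_2_if_two_edges)
    show "finite (edges G)" by (rule loopless_multigraph_finite[OF G])
    show "es ! i \<noteq> es ! j" using es i j by (simp add: nth_eq_iff_index_eq)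
    show "es ! i \<in> edges G" "es ! j \<in> edges G" using es i j by auto
    show "v \<in> ends G (es ! i)" "v \<in> ends G (es ! j)"
      using is_cycle_ends[OF cyc] i j by auto
  qed
qed

lemma deg_ge_2_if_spanning_trees_meet_in_cycle:
  assumes G: "loopless_multigraph G" and cyc: "is_cycle G vs es"
    and S: "spanning_tree G S" and T: "spanning_tree G T" and meet: "S \<inter> T \<subseteq> set es"
    and v: "v \<in> verts G"
  shows "deg G v \<ge> 2"
proof (cases "v \<in> set vs")
  case True
  then show ?thesis by (rule cycle_vertex_deg_ge_2[OF G cyc])
next
  case False
  have "hd vs \<in> verts G" "hd vs \<noteq> v" using cyc False by (auto simp: is_cycle_def)
  then have incident: "\<exists>e\<in>R. v \<in> ends G e" if "spanning_tree G R" for R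
    using that is_connected_has_incident_edge[of "G\<lparr>edges := R\<rparr>" "hd vs" v] v
    by (simp add: spanning_tree_def is_tree_def)
  obtain e f where e: "e \<in> S" "v \<in> ends G e" and f: "f \<in> T" "v \<in> ends G f"
    using incident S T by blast
  have "e \<noteq> f" using False meet e f is_cycle_ends_subset[OF cyc] by blast
  then show ?thesis
    using e f S T loopless_multigraph_finite[OF G]
    by (intro deg_ge_2_if_two_edges[of G e f]) (auto simp: spanning_tree_def)
qed

section \<open>Adding and redirecting one edge\<close>

definition put_edge :: "('v, 'e) multigraph \<Rightarrow> 'e \<Rightarrow> 'v set \<Rightarrow> ('v, 'e) multigraph" where
  "put_edge G e p =
     \<lparr>verts = verts G \<union> p, edges = insert e (edges G), ends = (ends G)(e := p)\<rparr>"

lemma put_edge_simps [simp]: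
  "verts (put_edge G e p) = verts G \<union> p"
  "edges (put_edge G e p) = insert e (edges G)"
  "ends (put_edge G e p) = (ends G)(e := p)"
  by (simp_all add: put_edge_def)

lemma loopless_put_edge:
  assumes "loopless_multigraph G" "card p = 2"
  shows "loopless_multigraph (put_edge G e p)"
  using assms card_gt_0_iff[of p] by (auto simp: loopless_multigraph_def)

lemma deg_put_edge:
  assumes "finite (edges G)"
  shows "deg (put_edge G e p) u + of_bool (e \<in> edges G \<and> u \<in> ends G e) = deg G u + of_bool (u \<in> p)"
proof -
  define A where "A = {a \<in> edges G - {e}. u \<in> ends G a}"
  have A: "finite A" "e \<notin> A" using assms by (auto simp: A_def)
  have "{a \<in> edges (put_edge G e p). u \<in> ends (put_edge G e p) a} =
      (if u \<in> p then insert e A else A)"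
    by (auto simp: A_def)
  moreover have "{a \<in> edges G. u \<in> ends G a} =
      (if e \<in> edges G \<and> u \<in> ends G e then insert e A else A)"
    by (auto simp: A_def)
  ultimately show ?thesis using A by (simp add: deg_def)
qed

lemma induced_cycle_put_edge:
  assumes ind: "induced_cycle G vs es" and e: "e \<notin> set es" and p: "\<not> p \<subseteq> set vs"
  shows "induced_cycle (put_edge G e p) vs es"
proof -
  let ?H = "put_edge G e p"
  have cyc: "is_cycle G vs es" using ind by (simp add: induced_cycle_def)
  have len: "length es = length vs" using cyc by (simp add: is_cycle_def)
  have same: "ends ?H f = ends G f" if "f \<in> set es" for f using that e by auto
  have "is_cycle ?H vs es"
    using cyc same len by (auto simp: is_cycle_def simp del: put_edge_simps(3))
  moreover have "\<exists>f\<in>set es. ends ?H g = ends ?H f" if "g \<in> edges ?H" "ends ?H g \<subseteq> set vs" for g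
    using that p ind same by (auto simp: induced_cycle_def split: if_splits)
  moreover have "multiplicity ?H (ends ?H f) = 1" if f: "f \<in> set es" for f
  proof -
    let ?parallel = "\<lambda>K. {g \<in> edges K. ends K g = ends G f}"
    have "multiplicity G (ends G f) = 1" using ind f by (simp add: induced_cycle_def)
    then have "card (?parallel G) = 1" by (simp add: multiplicity_def)
    moreover have "f \<in> ?parallel G" using f cyc by (auto simp: is_cycle_def)
    ultimately have "?parallel G = {f}" by (metis card_1_singletonE singletonD)
    moreover have "p \<noteq> ends G f" using p is_cycle_ends_subset[OF cyc f] by auto
    ultimately have "?parallel ?H = {f}" using f e by (auto split: if_splits)
    then show ?thesis using same[OF f] by (simp add: multiplicity_def)
  qed
  ultimately show ?thesis by (simp add: induced_cycle_def)
qed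

lemma minimally_connected_add_leaf:
  assumes G: "minimally_connected G" and fin: "finite (verts G)" "finite (edges G)"
    and "v \<notin> verts G" "x \<in> verts G" "e \<notin> edges G"
  shows "minimally_connected (put_edge G e {v, x})"
proof -
  let ?H = "put_edge G e {v, x}"
  have "is_connected ?H"
  proof (rule is_connected_transfer)
    show "is_connected G" using G by (simp add: minimally_connected_def)
    have "adj (ends G) (edges G) \<subseteq> adj (ends ?H) (edges ?H)"
      using \<open>e \<notin> edges G\<close> by (auto simp: adj_def)
    then show "adj (ends G) (edges G) \<subseteq> (adj (ends ?H) (edges ?H))\<^sup>*" by auto
    have "(v, x) \<in> (adj (ends ?H) (edges ?H))\<^sup>*" by (intro r_into_rtrancl adjI[of e]) auto
    then show "\<exists>u\<in>verts G. (w, u) \<in> (adj (ends ?H) (edges ?H))\<^sup>*"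
      if "w \<in> verts ?H - verts G" for w
      using that \<open>x \<in> verts G\<close> by auto
  qed auto
  then show ?thesis
    using G fin assms(4-6) by (simp add: minimally_connected_def insert_absorb)
qed

lemma minimally_connected_slide:
  assumes G: "minimally_connected G" and c: "c \<in> edges G" "ends G c = {x, y}"
    and e: "e \<in> edges G" "e \<noteq> c" "ends G e = {v, x}" and vy: "v \<in> verts G" "y \<in> verts G"
  shows "minimally_connected (put_edge G c {v, y})"
proof -
  let ?H = "put_edge G c {v, y}"
  let ?r = "(adj (ends ?H) (edges ?H))\<^sup>*"
  have "(v, y) \<in> ?r" by (intro r_into_rtrancl adjI[of c]) auto
  moreover have "(v, x) \<in> ?r" using e by (intro r_into_rtrancl adjI[of e]) auto
  ultimately have detour: "(x, y) \<in> ?r" "(y, x) \<in> ?r"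
    by (meson rtrancl_adj_sym rtrancl_trans)+
  have "is_connected ?H"
  proof (rule is_connected_replace_edge)
    show "is_connected G" using G by (simp add: minimally_connected_def)
    show "(a, b) \<in> ?r" if "ends G c = {a, b}" for a b
      using that c(2) detour by (auto simp: doubleton_eq_iff)
  qed (use vy in auto)
  then show ?thesis
    using G c(1) vy by (simp add: minimally_connected_def insert_absorb)
qed

section \<open>Pivot frames\<close>

text \<open>The trees are recorded as connected graphs with the right number of edges, which is easier to
  maintain than acyclicity.\<close>

definition pivot_frame ::
  "('v, 'e) multigraph \<Rightarrow> 'v list \<Rightarrow> 'e list \<Rightarrow> 'e set \<Rightarrow> 'e set \<Rightarrow> bool" where
  "pivot_frame G vs es S T \<longleftrightarrow>
     loopless_multigraph G \<and> induced_cycle G vs es \<and> length vs = 4 \<and>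
     minimally_connected (G\<lparr>edges := S\<rparr>) \<and> minimally_connected (G\<lparr>edges := T\<rparr>) \<and>
     S \<union> T = edges G \<and> card (S \<inter> T) = 2 \<and> S \<inter> T \<subseteq> set es"

lemma pivot_frame_sym: "pivot_frame G vs es S T \<Longrightarrow> pivot_frame G vs es T S"
  by (auto simp: pivot_frame_def Int_commute)

lemma pivot_frame_cycle_subset:
  assumes "pivot_frame G vs es S T"
  shows "set vs \<subseteq> verts G" "set es \<subseteq> edges G"
  using assms by (auto simp: pivot_frame_def induced_cycle_def is_cycle_def)

lemma pivot_frame_finite:
  assumes "pivot_frame G vs es S T"
  shows "finite (verts G)" "finite (edges G)" "finite S" "finite T"
proof -
  show "finite (verts G)" "finite (edges G)"
    using assms by (auto simp: pivot_frame_def intro: loopless_multigraph_finite)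
  then show "finite S" "finite T"
    using assms by (metis finite_Un pivot_frame_def)+
qed

lemma pivot_frame_card_edges:
  assumes "pivot_frame G vs es S T"
  shows "card (edges G) + 4 = 2 * card (verts G)"
  using card_Un_Int[OF pivot_frame_finite(3,4)[OF assms]] assms
  by (simp add: pivot_frame_def minimally_connected_def)

lemma pivot_frame_imp_C4_pivotable:
  assumes frame: "pivot_frame G vs es S T"
  shows "C4_pivotable G"
proof -
  have "spanning_tree G S" "spanning_tree G T"
    using frame pivot_frame_finite(3,4)[OF frame]
    by (auto simp: pivot_frame_def spanning_tree_def intro!: minimally_connected_imp_is_tree)
  moreover have "int (card (edges G)) = 2 * int (card (verts G)) - 4"
    using pivot_frame_card_edges[OF frame] by linarith
  ultimately show ?thesis
    using frame unfolding C4_pivotable_def pivot_frame_def by blast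
qed

lemma pivot_frame_obtain_edge_off_cycle:
  assumes frame: "pivot_frame G vs es S T" and card: "card (verts G) \<ge> 5"
  obtains S' T' c where "pivot_frame G vs es S' T'" "c \<in> S'" "c \<notin> set es"
proof -
  have "length es = 4"
    using frame by (auto simp: pivot_frame_def induced_cycle_def is_cycle_def)
  then have "card (set es) < card (edges G)"
    using pivot_frame_card_edges[OF frame] card card_length[of es] by simp
  then have "\<not> edges G \<subseteq> set es" using card_mono[of "set es" "edges G"] by auto
  then obtain c where "c \<in> edges G" "c \<notin> set es" by blast
  moreover from this have "c \<in> S \<or> c \<in> T" using frame by (auto simp: pivot_frame_def)
  ultimately show ?thesis using that frame pivot_frame_sym[OF frame] by blast
qed

definition attach_vertex ::
  "('v, 'e) multigraph \<Rightarrow> 'v \<Rightarrow> 'e \<Rightarrow> 'v \<Rightarrow> 'e \<Rightarrow> 'v \<Rightarrow> ('v, 'e) multigraph" where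
  "attach_vertex G v e x e' y = put_edge (put_edge G e {v, x}) e' {v, y}"

lemma deg_attach_vertex:
  assumes "finite (edges G)" "e \<notin> edges G" "e' \<notin> edges G" "e \<noteq> e'"
  shows "deg (attach_vertex G v e x e' y) u = deg G u + of_bool (u \<in> {v, x}) + of_bool (u \<in> {v, y})"
  using deg_put_edge[of G e "{v, x}" u] deg_put_edge[of "put_edge G e {v, x}" e' "{v, y}" u] assms
  by (simp add: attach_vertex_def)

lemma pivot_frame_attach_vertex:
  assumes frame: "pivot_frame G vs es S T" and v: "v \<notin> verts G" and xy: "x \<in> verts G" "y \<in> verts G"
    and e: "e \<notin> edges G" "e' \<notin> edges G" "e \<noteq> e'"
  shows "pivot_frame (attach_vertex G v e x e' y) vs es (insert e S) (insert e' T)"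
proof -
  let ?H = "attach_vertex G v e x e' y"
  have trees: "S \<union> T = edges G" "card (S \<inter> T) = 2" "S \<inter> T \<subseteq> set es" "length vs = 4"
    using frame by (auto simp: pivot_frame_def)
  note fin = pivot_frame_finite[OF frame] and sub = pivot_frame_cycle_subset[OF frame]
  have leaf: "minimally_connected (?H\<lparr>edges := insert g R\<rparr>)"
    if R: "minimally_connected (G\<lparr>edges := R\<rparr>)" "R \<subseteq> edges G"
      and g: "g \<notin> edges G" "ends ?H g = {v, w}" "w \<in> verts G" for R g w
  proof -
    have "finite R" using fin(2) R(2) by (rule rev_finite_subset)
    then have "minimally_connected (put_edge (G\<lparr>edges := R\<rparr>) g {v, w})"
      using R g fin(1) v by (intro minimally_connected_add_leaf) auto
    also have "?this \<longleftrightarrow> ?thesis"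
      using R(2) g xy e by (intro minimally_connected_cong) (auto simp: attach_vertex_def)
    finally show ?thesis .
  qed
  have "v \<noteq> x" "v \<noteq> y" using v xy by auto
  then have "loopless_multigraph ?H"
    using frame by (simp add: attach_vertex_def loopless_put_edge pivot_frame_def)
  moreover have "induced_cycle ?H vs es"
    unfolding attach_vertex_def using frame v e sub
    by (intro induced_cycle_put_edge) (auto simp: pivot_frame_def)
  moreover have "minimally_connected (?H\<lparr>edges := insert e S\<rparr>)"
    using frame xy e by (intro leaf[of S e x]) (auto simp: pivot_frame_def attach_vertex_def)
  moreover have "minimally_connected (?H\<lparr>edges := insert e' T\<rparr>)"
    using frame xy e by (intro leaf[of T e' y]) (auto simp: pivot_frame_def attach_vertex_def)
  moreover have "insert e S \<inter> insert e' T = S \<inter> T" using e trees by auto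
  moreover have "insert e S \<union> insert e' T = edges ?H" using trees by (auto simp: attach_vertex_def)
  ultimately show ?thesis using trees by (simp add: pivot_frame_def)
qed

lemma pivot_frame_slide:
  assumes frame: "pivot_frame G vs es S T"
    and c: "c \<in> S" "c \<notin> set es" "ends G c = {x, y}"
    and e: "e \<in> S" "e \<noteq> c" "ends G e = {v, x}" and v: "v \<notin> set vs" "v \<noteq> y"
  shows "pivot_frame (put_edge G c {v, y}) vs es S T"
proof -
  let ?H = "put_edge G c {v, y}"
  have trees: "S \<union> T = edges G" "card (S \<inter> T) = 2" "S \<inter> T \<subseteq> set es" "length vs = 4"
    using frame by (auto simp: pivot_frame_def)
  have "c \<in> edges G" "e \<in> edges G" using c e trees by auto
  then have vy: "v \<in> verts G" "y \<in> verts G"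
    using frame c(3) e(3) by (auto simp: pivot_frame_def loopless_multigraph_def)
  have "loopless_multigraph ?H"
    using frame v by (intro loopless_put_edge) (auto simp: pivot_frame_def)
  moreover have "induced_cycle ?H vs es"
    using frame c v by (intro induced_cycle_put_edge) (auto simp: pivot_frame_def)
  moreover have "minimally_connected (?H\<lparr>edges := S\<rparr>)"
  proof -
    have "minimally_connected (put_edge (G\<lparr>edges := S\<rparr>) c {v, y})"
      using frame c e vy
      by (intro minimally_connected_slide[of _ c x y e v]) (auto simp: pivot_frame_def)
    also have "?this \<longleftrightarrow> ?thesis"
      using c by (intro minimally_connected_cong) auto
    finally show ?thesis .
  qed
  moreover have "minimally_connected (?H\<lparr>edges := T\<rparr>)"
  proof -
    have "minimally_connected (G\<lparr>edges := T\<rparr>)" using frame by (simp add: pivot_frame_def)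
    also have "?this \<longleftrightarrow> ?thesis"
      using c vy trees by (intro minimally_connected_cong) auto
    finally show ?thesis .
  qed
  moreover have "S \<union> T = edges ?H" using trees c(1) by auto
  ultimately show ?thesis using trees by (simp add: pivot_frame_def)
qed

section \<open>The cycle on a list of vertices\<close>

definition cycle_graph :: "'v list \<Rightarrow> ('v, nat) multigraph" where
  "cycle_graph vs = \<lparr>verts = set vs, edges = {..<length vs},
     ends = (\<lambda>i. {vs ! i, vs ! (Suc i mod length vs)})\<rparr>"

lemma cycle_graph_simps [simp]:
  "verts (cycle_graph vs) = set vs"
  "edges (cycle_graph vs) = {..<length vs}"
  "ends (cycle_graph vs) i = {vs ! i, vs ! (Suc i mod length vs)}"
  by (simp_all add: cycle_graph_def)

lemma is_cycle_cycle_graph: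
  assumes "distinct vs" "vs \<noteq> []"
  shows "is_cycle (cycle_graph vs) vs [0..<length vs]"
  using assms by (auto simp: is_cycle_def)

lemma loopless_cycle_graph:
  assumes "distinct vs" "length vs \<ge> 2"
  shows "loopless_multigraph (cycle_graph vs)"
proof -
  have "Suc i mod length vs < length vs" "i \<noteq> Suc i mod length vs" if "i < length vs" for i
    using that assms(2) by (auto simp: mod_Suc)
  then show ?thesis
    using assms(1) by (auto simp: loopless_multigraph_def card_2_iff' nth_eq_iff_index_eq)
qed

lemma inj_on_ends_cycle_graph:
  assumes "distinct vs" "length vs \<ge> 3"
  shows "inj_on (ends (cycle_graph vs)) {..<length vs}"
proof (rule inj_onI)
  let ?s = "\<lambda>i. Suc i mod length vs"
  fix i j
  assume i: "i \<in> {..<length vs}" and j: "j \<in> {..<length vs}"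
    and eq: "ends (cycle_graph vs) i = ends (cycle_graph vs) j"
  have "?s i < length vs" "?s j < length vs" using assms(2) by (auto intro!: mod_less_divisor)
  then have "i = j \<or> i = ?s j \<and> j = ?s i"
    using eq i j assms(1) by (auto simp: doubleton_eq_iff nth_eq_iff_index_eq)
  then show "i = j" using i j assms(2) by (auto simp: mod_Suc split: if_splits)
qed

lemma induced_cycle_cycle_graph:
  assumes "distinct vs" "length vs \<ge> 3"
  shows "induced_cycle (cycle_graph vs) vs [0..<length vs]"
proof -
  let ?G = "cycle_graph vs"
  have "multiplicity ?G (ends ?G i) = 1" if "i < length vs" for i
  proof -
    have "{j \<in> edges ?G. ends ?G j = ends ?G i} = {i}"
      using inj_on_ends_cycle_graph[OF assms] that
      by (auto simp: inj_on_def simp del: cycle_graph_simps(3))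
    then show ?thesis by (simp add: multiplicity_def)
  qed
  moreover have "is_cycle ?G vs [0..<length vs]"
    using assms by (intro is_cycle_cycle_graph) auto
  ultimately show ?thesis by (auto simp: induced_cycle_def simp del: cycle_graph_simps(3))
qed

lemma deg_cycle_graph:
  assumes "distinct vs" "length vs \<ge> 2" "v \<in> set vs"
  shows "deg (cycle_graph vs) v = 2"
proof -
  let ?G = "cycle_graph vs"
  have loopless: "loopless_multigraph ?G" using assms by (intro loopless_cycle_graph)
  have "is_cycle ?G vs [0..<length vs]" using assms by (intro is_cycle_cycle_graph) auto
  then have ge: "2 \<le> deg ?G u" if "u \<in> set vs" for u
    using cycle_vertex_deg_ge_2[OF loopless] that by blast
  have "(\<Sum>u\<in>set vs. 2) = (\<Sum>u\<in>set vs. deg ?G u)"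
    using handshake[OF loopless] assms(1) by (simp add: distinct_card)
  from sum_mono_inv[OF this ge assms(3)] show ?thesis by simp
qed

lemma minimally_connected_cycle_graph_delete_edge:
  assumes "distinct vs" "i < length vs"
  shows "minimally_connected (cycle_graph vs\<lparr>edges := {..<length vs} - {i}\<rparr>)"
proof -
  have cyc: "is_cycle (cycle_graph vs) vs [0..<length vs]"
    using assms by (intro is_cycle_cycle_graph) auto
  have "is_connected (cycle_graph vs\<lparr>edges := {..<length vs} - {i}\<rparr>)"
    using rtrancl_adj_cycle_delete_edge[OF cyc, of i] assms
    by (auto simp: is_connected_adj atLeast0LessThan)
  then show ?thesis using assms by (simp add: minimally_connected_def distinct_card)
qed

lemma pivot_frame_cycle_graph:
  assumes "distinct vs" "length vs = 4"
  shows "pivot_frame (cycle_graph vs) vs [0..<4] ({..<4} - {3}) ({..<4} - {0})"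
proof -
  have "({..<4} - {3}) \<inter> ({..<4} - {0}) = {1, 2 :: nat}" by auto
  moreover have "({..<4} - {3}) \<union> ({..<4} - {0}) = {..<4 :: nat}" by auto
  ultimately show ?thesis
    using assms loopless_cycle_graph[of vs] induced_cycle_cycle_graph[of vs]
      minimally_connected_cycle_graph_delete_edge[of vs]
    by (simp add: pivot_frame_def)
qed

section \<open>Degree sequences of pivotable multigraphs\<close>

definition frame_realizable :: "'v set \<Rightarrow> ('v \<Rightarrow> nat) \<Rightarrow> bool" where
  "frame_realizable V d \<longleftrightarrow> (\<exists>(G :: ('v, nat) multigraph) vs es S T.
     pivot_frame G vs es S T \<and> verts G = V \<and> (\<forall>v\<in>V. deg G v = d v))"

lemma obtain_two_fresh:
  assumes "finite (E :: nat set)"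
  obtains e e' where "e \<notin> E" "e' \<notin> E" "e \<noteq> e'"
proof -
  obtain e where e: "e \<notin> E" using assms ex_new_if_finite infinite_UNIV_nat by blast
  obtain e' where "e' \<notin> insert e E"
    using assms ex_new_if_finite[of "insert e E"] infinite_UNIV_nat by auto
  with e that show ?thesis by auto
qed

lemma frame_realizable_add_degree_2:
  assumes real: "frame_realizable V d'" and v: "v \<notin> V" "d v = 2" and xy: "x \<in> V" "y \<in> V"
    and d: "\<And>u. u \<in> V \<Longrightarrow> d u = d' u + of_bool (u = x) + of_bool (u = y)"
  shows "frame_realizable (insert v V) d"
proof -
  obtain G :: "('a, nat) multigraph" and vs es S T where
    frame: "pivot_frame G vs es S T" and V: "verts G = V" and deg: "\<forall>v\<in>V. deg G v = d' v"
    using real by (auto simp: frame_realizable_def)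
  have loopless: "loopless_multigraph G" using frame by (simp add: pivot_frame_def)
  note fin = pivot_frame_finite(2)[OF frame]
  obtain e e' where e: "e \<notin> edges G" "e' \<notin> edges G" "e \<noteq> e'"
    using obtain_two_fresh[OF fin] .
  let ?H = "attach_vertex G v e x e' y"
  have "pivot_frame ?H vs es (insert e S) (insert e' T)"
    using v xy e V by (intro pivot_frame_attach_vertex[OF frame]) auto
  moreover have "verts ?H = insert v V" using xy V by (auto simp: attach_vertex_def)
  moreover have "deg ?H u = d u" if "u \<in> insert v V" for u
    using that deg_attach_vertex[OF fin e, of v x y u] deg_outside[OF loopless, of v] deg d v xy V
    by (cases "u = v") auto
  ultimately show ?thesis unfolding frame_realizable_def by blast
qed

lemma frame_realizable_add_degree_3:
  assumes real: "frame_realizable V d'" and card: "card V \<ge> 5"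
    and v: "v \<notin> V" "d v = 3" and z: "z \<in> V"
    and d: "\<And>u. u \<in> V \<Longrightarrow> d u = d' u + of_bool (u = z)"
  shows "frame_realizable (insert v V) d"
proof -
  obtain G :: "('a, nat) multigraph" and vs es S\<^sub>0 T\<^sub>0 where
    frame\<^sub>0: "pivot_frame G vs es S\<^sub>0 T\<^sub>0" and V: "verts G = V" and deg: "\<forall>v\<in>V. deg G v = d' v"
    using real by (auto simp: frame_realizable_def)
  have loopless: "loopless_multigraph G" using frame\<^sub>0 by (simp add: pivot_frame_def)
  note fin = pivot_frame_finite(2)[OF frame\<^sub>0]
  obtain e e' where e: "e \<notin> edges G" "e' \<notin> edges G" "e \<noteq> e'"
    using obtain_two_fresh[OF fin] .
  obtain S T c where frame: "pivot_frame G vs es S T" and c: "c \<in> S" "c \<notin> set es"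
    using pivot_frame_obtain_edge_off_cycle[OF frame\<^sub>0] card V by metis
  then have "c \<in> edges G" by (auto simp: pivot_frame_def)
  then have ce: "c \<noteq> e" "c \<noteq> e'" using e by auto
  have "ends G c \<subseteq> V" "card (ends G c) = 2"
    using loopless \<open>c \<in> edges G\<close> V by (auto simp: loopless_multigraph_def)
  then obtain x y where xy: "ends G c = {x, y}" "x \<noteq> y" "x \<in> V" "y \<in> V"
    by (auto simp: card_2_iff)
  let ?K = "attach_vertex G v e x e' z"
  let ?H = "put_edge ?K c {v, y}"
  have ends_K: "ends ?K c = {x, y}" "ends ?K e = {v, x}" and c_K: "c \<in> edges ?K"
    using ce e xy \<open>c \<in> edges G\<close> by (auto simp: attach_vertex_def)
  have "pivot_frame ?K vs es (insert e S) (insert e' T)"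
    using v xy z e V by (intro pivot_frame_attach_vertex[OF frame]) auto
  then have frame_H: "pivot_frame ?H vs es (insert e S) (insert e' T)"
    using c ce ends_K v xy V pivot_frame_cycle_subset[OF frame]
    by (intro pivot_frame_slide[of ?K _ _ _ _ c x y e]) auto
  have verts: "verts ?H = insert v V" using xy z V by (auto simp: attach_vertex_def)
  have "deg ?H u = d u" if "u \<in> insert v V" for u
  proof -
    have "deg ?H u + of_bool (u \<in> {x, y}) =
        deg G u + of_bool (u \<in> {v, x}) + of_bool (u \<in> {v, z}) + of_bool (u \<in> {v, y})"
      using deg_put_edge[of ?K c "{v, y}" u] fin ends_K c_K deg_attach_vertex[OF fin e, of v x z u]
      by (simp add: attach_vertex_def)
    then show ?thesis
      using that deg_outside[OF loopless, of v] deg d v xy z V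
      by (auto simp: of_bool_def split: if_splits)
  qed
  then show ?thesis unfolding frame_realizable_def using frame_H verts by blast
qed

definition pivotable_degrees :: "'v set \<Rightarrow> ('v \<Rightarrow> nat) \<Rightarrow> bool" where
  "pivotable_degrees V d \<longleftrightarrow> finite V \<and> (\<forall>v\<in>V. d v \<ge> 2) \<and> (\<Sum>v\<in>V. d v) + 8 = 4 * card V"

lemma pivotable_degrees_deg:
  assumes "C4_pivotable G"
  shows "pivotable_degrees (verts G) (deg G)"
proof -
  have loopless: "loopless_multigraph G" using assms by (simp add: C4_pivotable_def)
  have "card (edges G) + 4 = 2 * card (verts G)"
    using assms by (auto simp: C4_pivotable_def)
  then have "(\<Sum>v\<in>verts G. deg G v) + 8 = 4 * card (verts G)"
    using handshake[OF loopless] by simp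
  moreover have "deg G v \<ge> 2" if "v \<in> verts G" for v
    using assms that deg_ge_2_if_spanning_trees_meet_in_cycle[OF loopless]
    by (auto simp: C4_pivotable_def induced_cycle_def)
  ultimately show ?thesis
    using loopless_multigraph_finite[OF loopless] by (simp add: pivotable_degrees_def)
qed

lemma pivotable_degrees_card_ge_4:
  assumes "pivotable_degrees V d"
  shows "card V \<ge> 4"
proof -
  have "(\<Sum>u\<in>V. 2) \<le> (\<Sum>u\<in>V. d u)"
    using assms by (intro sum_mono) (simp add: pivotable_degrees_def)
  then show ?thesis using assms by (simp add: pivotable_degrees_def)
qed

lemma pivotable_degrees_obtain_2_or_3:
  assumes deg: "pivotable_degrees V d"
  obtains (degree_2) v where "v \<in> V" "d v = 2"
    | (degree_3) v where "v \<in> V" "d v = 3" "card V \<ge> 8"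
proof (cases "\<exists>v\<in>V. d v = 2")
  case False
  then have ge_3: "d u \<ge> 3" if "u \<in> V" for u
    using deg that by (force simp: pivotable_degrees_def)
  then have "(\<Sum>u\<in>V. 3) \<le> (\<Sum>u\<in>V. d u)" by (intro sum_mono)
  then have "card V \<ge> 8" using deg by (simp add: pivotable_degrees_def)
  moreover have "\<exists>v\<in>V. d v = 3"
  proof (rule ccontr)
    assume "\<not> ?thesis"
    then have "(\<Sum>u\<in>V. 4) \<le> (\<Sum>u\<in>V. d u)" using ge_3 by (intro sum_mono) force
    then show False using deg by (simp add: pivotable_degrees_def)
  qed
  ultimately show ?thesis using that(2) by blast
qed (use that(1) in blast)

lemma obtain_lowered_entry:
  fixes d :: "'v \<Rightarrow> nat"
  assumes fin: "finite V" and ge: "\<forall>u\<in>V. d u \<ge> k" and sum: "(\<Sum>u\<in>V. d u) > k * card V"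
  obtains x d' where "x \<in> V" "\<And>u. d u = d' u + of_bool (u = x)" "\<forall>u\<in>V. d' u \<ge> k"
    "(\<Sum>u\<in>V. d u) = (\<Sum>u\<in>V. d' u) + 1"
proof -
  have "\<exists>x\<in>V. d x > k"
  proof (rule ccontr)
    assume "\<not> ?thesis"
    then have "(\<Sum>u\<in>V. d u) \<le> (\<Sum>u\<in>V. k)" by (intro sum_mono) force
    then show False using sum by (simp add: mult.commute)
  qed
  then obtain x where x: "x \<in> V" "d x > k" by blast
  define d' where "d' = d(x := d x - 1)"
  have d: "d u = d' u + of_bool (u = x)" for u using x by (simp add: d'_def)
  moreover have "(\<Sum>u\<in>V. d u) = (\<Sum>u\<in>V. d' u) + 1"
    unfolding d sum.distrib using fin x by (simp add: of_bool_def)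
  moreover have "\<forall>u\<in>V. d' u \<ge> k" using ge x by (simp add: d'_def)
  ultimately show ?thesis using that x(1) by blast
qed

lemma pivotable_degrees_sum_remove:
  assumes deg: "pivotable_degrees V d" and v: "v \<in> V"
  shows "(\<Sum>u\<in>V - {v}. d u) + d v + 4 = 4 * card (V - {v})"
proof -
  have fin: "finite V" using deg by (simp add: pivotable_degrees_def)
  have "(\<Sum>u\<in>V. d u) = d v + (\<Sum>u\<in>V - {v}. d u)" using fin v by (rule sum.remove)
  moreover have "card V = card (V - {v}) + 1" using card_Suc_Diff1[OF fin v] by simp
  ultimately show ?thesis using deg unfolding pivotable_degrees_def by linarith
qed

lemma pivotable_degrees_remove_degree_2:
  assumes deg: "pivotable_degrees V d" and v: "v \<in> V" "d v = 2" and card: "card V > 4"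
  obtains x y d' where "x \<in> V - {v}" "y \<in> V - {v}" "pivotable_degrees (V - {v}) d'"
    "\<And>u. d u = d' u + of_bool (u = x) + of_bool (u = y)"
proof -
  let ?V = "V - {v}"
  have fin: "finite ?V" and ge: "\<forall>u\<in>?V. d u \<ge> 2"
    using deg by (auto simp: pivotable_degrees_def)
  have card_V: "card ?V \<ge> 4" using v(1) card by (simp add: card_Diff_singleton)
  have sum: "(\<Sum>u\<in>?V. d u) + 6 = 4 * card ?V"
    using pivotable_degrees_sum_remove[OF deg v(1)] v(2) by linarith
  then have "(\<Sum>u\<in>?V. d u) > 2 * card ?V" using card_V by linarith
  then obtain x d\<^sub>1 where x: "x \<in> ?V" "\<And>u. d u = d\<^sub>1 u + of_bool (u = x)" "\<forall>u\<in>?V. d\<^sub>1 u \<ge> 2"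
    "(\<Sum>u\<in>?V. d u) = (\<Sum>u\<in>?V. d\<^sub>1 u) + 1"
    using obtain_lowered_entry[OF fin ge] by blast
  have "(\<Sum>u\<in>?V. d\<^sub>1 u) > 2 * card ?V" using sum x(4) card_V by linarith
  then obtain y d' where y: "y \<in> ?V" "\<And>u. d\<^sub>1 u = d' u + of_bool (u = y)" "\<forall>u\<in>?V. d' u \<ge> 2"
    "(\<Sum>u\<in>?V. d\<^sub>1 u) = (\<Sum>u\<in>?V. d' u) + 1"
    using obtain_lowered_entry[OF fin x(3)] by blast
  have "pivotable_degrees ?V d'"
    using fin sum x(4) y by (simp add: pivotable_degrees_def)
  moreover have "d u = d' u + of_bool (u = x) + of_bool (u = y)" for u
    by (simp add: x(2) y(2))
  ultimately show ?thesis using that x(1) y(1) by blast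
qed

lemma pivotable_degrees_remove_degree_3:
  assumes deg: "pivotable_degrees V d" and v: "v \<in> V" "d v = 3" and card: "card V > 4"
  obtains z d' where "z \<in> V - {v}" "pivotable_degrees (V - {v}) d'"
    "\<And>u. d u = d' u + of_bool (u = z)"
proof -
  let ?V = "V - {v}"
  have fin: "finite ?V" and ge: "\<forall>u\<in>?V. d u \<ge> 2"
    using deg by (auto simp: pivotable_degrees_def)
  have sum: "(\<Sum>u\<in>?V. d u) + 7 = 4 * card ?V"
    using pivotable_degrees_sum_remove[OF deg v(1)] v(2) by linarith
  moreover have "card ?V \<ge> 4" using v(1) card by (simp add: card_Diff_singleton)
  ultimately have "(\<Sum>u\<in>?V. d u) > 2 * card ?V" by linarith
  then obtain z d' where z: "z \<in> ?V" "\<And>u. d u = d' u + of_bool (u = z)" "\<forall>u\<in>?V. d' u \<ge> 2"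
    "(\<Sum>u\<in>?V. d u) = (\<Sum>u\<in>?V. d' u) + 1"
    using obtain_lowered_entry[OF fin ge] by blast
  have "pivotable_degrees ?V d'"
    using fin sum z by (simp add: pivotable_degrees_def)
  then show ?thesis using that z by blast
qed

lemma frame_realizable_if_card_4:
  assumes deg: "pivotable_degrees V d" and card: "card V = 4"
  shows "frame_realizable V d"
proof -
  obtain vs where vs: "set vs = V" "distinct vs"
    using deg finite_distinct_list by (auto simp: pivotable_degrees_def)
  then have len: "length vs = 4" using card by (simp add: distinct_card[symmetric])
  have "(\<Sum>u\<in>V. 2) = (\<Sum>u\<in>V. d u)" using deg card by (simp add: pivotable_degrees_def)
  then have "d v = 2" if "v \<in> V" for v
    using sum_mono_inv[of "\<lambda>_. 2" V d v] deg that by (simp add: pivotable_degrees_def)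
  then have "\<forall>v\<in>V. deg (cycle_graph vs) v = d v"
    using deg_cycle_graph[OF vs(2)] vs(1) len by simp
  then show ?thesis
    unfolding frame_realizable_def using pivot_frame_cycle_graph[OF vs(2) len] vs(1) by fastforce
qed

lemma frame_realizable_if_pivotable_degrees:
  assumes "pivotable_degrees V d"
  shows "frame_realizable V d"
  using assms
proof (induction "card V" arbitrary: V d rule: less_induct)
  case less
  note deg = less.prems
  have fin: "finite V" using deg by (simp add: pivotable_degrees_def)
  consider (base) "card V = 4" | (step) "card V > 4"
    using pivotable_degrees_card_ge_4[OF deg] by linarith
  then show ?case
  proof cases
    case base
    then show ?thesis by (rule frame_realizable_if_card_4[OF deg])
  next
    case step
    have IH: "frame_realizable (V - {v}) d'" if "v \<in> V" "pivotable_degrees (V - {v}) d'" for v d'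
      using that fin by (intro less.hyps card_Diff1_less)
    from deg show ?thesis
    proof (cases rule: pivotable_degrees_obtain_2_or_3)
      case v: (degree_2 v)
      then obtain x y d' where "x \<in> V - {v}" "y \<in> V - {v}" "pivotable_degrees (V - {v}) d'"
        "\<And>u. d u = d' u + of_bool (u = x) + of_bool (u = y)"
        using pivotable_degrees_remove_degree_2[OF deg _ _ step] by metis
      then have "frame_realizable (insert v (V - {v})) d"
        using v by (intro frame_realizable_add_degree_2[OF IH]) auto
      then show ?thesis using v by (simp add: insert_absorb)
    next
      case v: (degree_3 v)
      then obtain z d' where "z \<in> V - {v}" "pivotable_degrees (V - {v}) d'"
        "\<And>u. d u = d' u + of_bool (u = z)"
        using pivotable_degrees_remove_degree_3[OF deg _ _ step] by metis
      then have "frame_realizable (insert v (V - {v})) d"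
        using v by (intro frame_realizable_add_degree_3[OF IH]) auto
      then show ?thesis using v by (simp add: insert_absorb)
    qed
  qed
qed

lemma pivotable_degrees_degree_sequence_iff:
  assumes "degree_sequence n d" "n \<ge> 1"
  shows "pivotable_degrees {1..n} d \<longleftrightarrow>
    (\<Sum>i=1..n. int (d i)) = 4 * (int n - 1) - 4 \<and> d n \<ge> 2"
proof -
  have "(\<forall>i\<in>{1..n}. d i \<ge> 2) \<longleftrightarrow> d n \<ge> 2"
    using assms by (auto simp: degree_sequence_def intro: le_trans)
  moreover have "s + 8 = 4 * n \<longleftrightarrow> int s = 4 * (int n - 1) - 4" for s
    by presburger
  ultimately show ?thesis by (auto simp: pivotable_degrees_def simp flip: of_nat_sum)
qed

theorem theorem5p4:
  fixes n :: nat and d :: "nat \<Rightarrow> nat"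
  assumes "n \<ge> 1" and "multigraphical n d"
  shows "(\<exists>G :: (nat, nat) multigraph. realization G n d \<and> C4_pivotable G) \<longleftrightarrow>
    (\<Sum>i=1..n. int (d i)) = 4 * (int n - 1) - 4 \<and> d n \<ge> 2"
proof -
  have "pivotable_degrees {1..n} d"
    if "realization G n d" "C4_pivotable G" for G :: "(nat, nat) multigraph"
    using pivotable_degrees_deg[OF that(2)] that(1)
    by (simp add: realization_def pivotable_degrees_def)
  moreover have "\<exists>G :: (nat, nat) multigraph. realization G n d \<and> C4_pivotable G"
    if deg: "pivotable_degrees {1..n} d"
  proof -
    obtain G :: "(nat, nat) multigraph" and vs es S T
      where "pivot_frame G vs es S T" "verts G = {1..n}" "\<forall>i\<in>{1..n}. deg G i = d i"
      using frame_realizable_if_pivotable_degrees[OF deg] by (auto simp: frame_realizable_def)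
    moreover from this have "realization G n d" by (simp add: realization_def pivot_frame_def)
    ultimately show ?thesis using pivot_frame_imp_C4_pivotable by blast
  qed
  moreover have "degree_sequence n d" using assms(2) by (simp add: multigraphical_def)
  ultimately show ?thesis using pivotable_degrees_degree_sequence_iff assms(1) by blast
qed

end
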